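(* Let $a,b\ge 1$, $P=[a]\times[b]$ and $n=a+b$. Then the piecewise-linear rowmotion map $\rho_{\mathcal P}:\mathcal O(P)\to\mathcal O(P)$ and the piecewise-linear promotion map $\pi_{\mathcal P}:\mathcal O(P)\to\mathcal O(P)$ both have order $n$: $\rho_{\mathcal P}^{\,n}$ and $\pi_{\mathcal P}^{\,n}$ are the identity map on $\mathcal O(P)$, and no smaller positive power of either map is the identity.
   Context: $[a]\times[b]=\{(i,j)\in\mathbb Z^2:1\le i\le a,\ 1\le j\le b\}$ with $(i,j)\le(i',j')$ iff $i\le i'$ and $j\le j'$. For a finite poset $P$, let $\widehat P=P\cup\{\hat0,\hat1\}$ with $\hat0<x<\hat1$ for all $x\in P$, and write $y\lessdot x$ ($x$ covers $y$) when $y<x$ and no $z$ satisfies $y<z<x$. The order polytope $\mathcal O(P)$ is the set of order-preserving maps $f:P\to[0,1]$ (i.e. $x\le y\Rightarrow f(x)\le f(y)$); each such $f$ is extended to $\hat f$ on $\widehat P$ by $\hat f(\hat0)=0$, $\hat f(\hat1)=1$. For $x\in P$ the piecewise-linear toggle $\tau_x:\mathcal O(P)\to\mathcal O(P)$ leaves $f(y)$ unchanged for $y\ne x$ and sets $(\tau_xf)(x)=\max\{\hat f(y):y\in\widehat P,\ y\lessdot x\}+\min\{\hat f(y):y\in\widehat P,\ y\gtrdot x\}-f(x)$. Piecewise-linear rowmotion is $\rho_{\mathcal P}=\tau_{x_1}\circ\tau_{x_2}\circ\cdots\circ\tau_{x_p}$ where $x_1,\dots,x_p$ is any linear extension of $P$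 (so elements are toggled from the top of $P$ to the bottom; the result does not depend on the linear extension). For $P=[a]\times[b]$, the $k$-th file ($1\le k\le n-1$) is $\{(i,j)\in P: j-i+a=k\}$; let $\tau^*_k$ be the composition of the (pairwise commuting) toggles $\tau_x$ over $x$ in the $k$-th file, and define piecewise-linear promotion $\pi_{\mathcal P}=\tau^*_{n-1}\circ\cdots\circ\tau^*_2\circ\tau^*_1$ (files toggled from $1$ to $n-1$). *)

theory Defs
  imports Complex_Main "HOL-Library.Product_Lexorder"
begin

datatype 'a ext = Bot | Elt 'a | Top

fun hat_le :: "('a \<Rightarrow> 'a \<Rightarrow> bool) \<Rightarrow> 'a ext \<Rightarrow> 'a ext \<Rightarrow> bool" where
  "hat_le le Bot v = True"
| "hat_le le u Top = True"
| "hat_le le (Elt x) (Elt y) = le x y"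
| "hat_le le _ _ = False"

definition hat_set :: "'a set \<Rightarrow> 'a ext set" where
  "hat_set P = {Bot, Top} \<union> Elt ` P"

definition covered_by :: "'b set \<Rightarrow> ('b \<Rightarrow> 'b \<Rightarrow> bool) \<Rightarrow> 'b \<Rightarrow> 'b \<Rightarrow> bool" where
  "covered_by S le y x \<longleftrightarrow> y \<in> S \<and> x \<in> S \<and> le y x \<and> y \<noteq> x \<and>
     \<not> (\<exists>z\<in>S. le y z \<and> z \<noteq> y \<and> le z x \<and> z \<noteq> x)"

fun hat_f :: "('a \<Rightarrow> real) \<Rightarrow> 'a ext \<Rightarrow> real" where
  "hat_f f Bot = 0"
| "hat_f f Top = 1"
| "hat_f f (Elt x) = f x"

text \<open>Order polytope; maps are represented as total functions that vanish off P.\<close>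
definition order_polytope :: "'a set \<Rightarrow> ('a \<Rightarrow> 'a \<Rightarrow> bool) \<Rightarrow> ('a \<Rightarrow> real) set" where
  "order_polytope P le = {f. (\<forall>x\<in>P. 0 \<le> f x \<and> f x \<le> 1) \<and>
      (\<forall>x\<in>P. \<forall>y\<in>P. le x y \<longrightarrow> f x \<le> f y) \<and> (\<forall>x. x \<notin> P \<longrightarrow> f x = 0)}"

definition toggle :: "'a set \<Rightarrow> ('a \<Rightarrow> 'a \<Rightarrow> bool) \<Rightarrow> 'a \<Rightarrow> ('a \<Rightarrow> real) \<Rightarrow> ('a \<Rightarrow> real)" where
  "toggle P le x f = f(x :=
      Max {hat_f f y | y. covered_by (hat_set P) (hat_le le) y (Elt x)}
    + Min {hat_f f y | y. covered_by (hat_set P) (hat_le le) (Elt x) y}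
    - f x)"

definition linear_extension :: "'a set \<Rightarrow> ('a \<Rightarrow> 'a \<Rightarrow> bool) \<Rightarrow> 'a list \<Rightarrow> bool" where
  "linear_extension P le xs \<longleftrightarrow> distinct xs \<and> set xs = P \<and>
     (\<forall>i<length xs. \<forall>j<length xs. le (xs ! i) (xs ! j) \<longrightarrow> i \<le> j)"

definition pl_rowmotion :: "'a set \<Rightarrow> ('a \<Rightarrow> 'a \<Rightarrow> bool) \<Rightarrow> ('a \<Rightarrow> real) \<Rightarrow> ('a \<Rightarrow> real)" where
  "pl_rowmotion P le =
     foldr (\<lambda>x acc. toggle P le x \<circ> acc) (SOME xs. linear_extension P le xs) id"

definition grid :: "nat \<Rightarrow> nat \<Rightarrow> (nat \<times> nat) set" where
  "grid a b = {(i, j). 1 \<le> i \<and> i \<le> a \<and> 1 \<le> j \<and> j \<le> b}"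

fun grid_le :: "nat \<times> nat \<Rightarrow> nat \<times> nat \<Rightarrow> bool" where
  "grid_le (i, j) (i', j') \<longleftrightarrow> i \<le> i' \<and> j \<le> j'"

definition grid_file :: "nat \<Rightarrow> nat \<Rightarrow> nat \<Rightarrow> (nat \<times> nat) set" where
  "grid_file a b k = {(i, j) \<in> grid a b. int j - int i + int a = int k}"

text \<open>tau*_k: composition of the (commuting) toggles in the k-th file.\<close>
definition file_toggle :: "nat \<Rightarrow> nat \<Rightarrow> nat \<Rightarrow> ((nat \<times> nat) \<Rightarrow> real) \<Rightarrow> ((nat \<times> nat) \<Rightarrow> real)" where
  "file_toggle a b k = fold (toggle (grid a b) grid_le) (sorted_list_of_set (grid_file a b k))"

definition pl_promotion :: "nat \<Rightarrow> nat \<Rightarrow> ((nat \<times> nat) \<Rightarrow> real) \<Rightarrow> ((nat \<times> nat) \<Rightarrow> real)" where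
  "pl_promotion a b = fold (file_toggle a b) [1..<a + b]"

end

theory Submission
  imports Defs
begin

text \<open>Rowmotion is first lifted to positive labellings, replacing \<open>max\<close>, \<open>min\<close> and \<open>+\<close> by addition,
  parallel addition and multiplication, and recovered by taking logarithmic growth rates; thus it suffices to find
  the period of a birational orbit \<open>X\<^sub>0, X\<^sub>1, \<dots>\<close>. There the quotients
  \<open>A\<^sub>l(v) = X\<^sub>l(v) / \<Sum>\<^bsub>u covered by v\<^esub> X\<^sub>l(u)\<close> and \<open>V\<^sub>l(v) = 1 / (X\<^sub>l(v) \<Sum>\<^bsub>w covering v\<^esub> 1 / X\<^sub>l(w))\<close> satisfy \<open>V\<^sub>l\<^sub>+\<^sub>1 = A\<^sub>l\<close>, and
  \<open>X\<^sub>l\<close> and \<open>1 / X\<^sub>l\<close> are sums of products of the \<open>A\<^sub>l\<close>, respectively the \<open>V\<^sub>l\<close>, over lattice paths. The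
  \<open>V\<^sub>l\<close>-path sum from \<open>(a, k)\<close> to \<open>(1, m)\<close> equals the \<open>A\<^sub>l\<close>-path sum from \<open>(a, k + 1)\<close> to \<open>(1, m + 1)\<close>, so path
  sums can be pushed across the rectangle while time advances. This gives the reciprocity
  \<open>X\<^sub>l\<^sub>+\<^sub>i\<^sub>+\<^sub>j\<^sub>-\<^sub>1(i, j) X\<^sub>l(a + 1 - i, b + 1 - j) = \<beta>\<close>, first in row \<open>1\<close> and then, by the recurrence, in every row; applied
  twice it gives the period \<open>a + b\<close> (compare Grinberg and Roby on noncommutative birational rowmotion).
  Promotion orbits are rowmotion orbits after a column-dependent shift of time.\<close>

subsection \<open>Path sums\<close>

text \<open>\<open>H j\<close> sums over all lattice paths from \<open>(1, m + 1)\<close> to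
  \<open>(a, k + 1)\<close>, split by the row in which they pass from column \<open>j\<close> to
  column \<open>j + 1\<close>. The total does not depend on the cut; the two extreme cuts give the
  two sides.\<close>

lemma path_sum_flow:
  fixes F G w :: "nat \<Rightarrow> nat \<Rightarrow> real"
  assumes "m \<le> k" "1 \<le> a"
    and F: "\<And>i j. 1 \<le> i \<Longrightarrow> i \<le> a \<Longrightarrow> Suc m \<le> j \<Longrightarrow> j \<le> Suc k \<Longrightarrow> F i j = w i j * (F (i - 1) j + F i (j - 1))"
    and F0: "\<And>j. F 0 j = 0" and Fm: "\<And>i. 1 \<le> i \<Longrightarrow> i \<le> a \<Longrightarrow> F i m = (if i = 1 then 1 else 0)"
    and G: "\<And>i j. 1 \<le> i \<Longrightarrow> i \<le> a \<Longrightarrow> Suc m \<le> j \<Longrightarrow> j \<le> Suc k \<Longrightarrow> G i j = w i j * (G (Suc i) j + G i (Suc j))"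
    and Ga: "\<And>j. G (Suc a) j = 0"
    and Gk: "\<And>i. 1 \<le> i \<Longrightarrow> i \<le> a \<Longrightarrow> G i (Suc (Suc k)) = (if i = a then 1 else 0)"
  shows "F a (Suc k) = G 1 (Suc m)"
proof -
  define H where "H j = (\<Sum>i=1..a. F i j * G i (Suc j))" for j
  have step: "H j = H (Suc j)" if "m \<le> j" "j \<le> k" for j
  proof -
    have "H j - H (Suc j) = (\<Sum>i=1..a. F i j * G i (Suc j) - F i (Suc j) * G i (Suc (Suc j)))"
      by (simp add: H_def sum_subtractf)
    \<comment> \<open>Both recurrences carry the weight of cell \<open>(i, j + 1)\<close>, so inflow
      and outflow balance there; what remains is flow inside the column, and it telescopes.\<close>
    also have "\<dots> = (\<Sum>i=1..a. F i (Suc j) * G (Suc i) (Suc j) - F (i - 1) (Suc j) * G i (Suc j))"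
    proof (rule sum.cong)
      fix i assume "i \<in> {1..a}"
      then show "F i j * G i (Suc j) - F i (Suc j) * G i (Suc (Suc j)) =
          F i (Suc j) * G (Suc i) (Suc j) - F (i - 1) (Suc j) * G i (Suc j)"
        using F[of i "Suc j"] G[of i "Suc j"] that by (simp add: algebra_simps)
    qed simp
    also have "\<dots> = (\<Sum>i=1..a. F (Suc i - 1) (Suc j) * G (Suc i) (Suc j) - F (i - 1) (Suc j) * G i (Suc j))"
      by simp
    also have "\<dots> = 0"
      by (subst sum_Suc_diff) (use Ga F0 \<open>1 \<le> a\<close> in auto)
    finally show ?thesis by simp
  qed
  have "H (Suc k) = H m"
    using \<open>m \<le> k\<close> by (rule dec_induct[where P = "\<lambda>n. n \<le> Suc k \<longrightarrow> H n = H m", THEN mp, OF le_SucI]) (use step in auto)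
  moreover have "H m = (\<Sum>i=1..a. if i = 1 then G 1 (Suc m) else 0)"
    unfolding H_def by (intro sum.cong) (auto simp: Fm)
  moreover have "H (Suc k) = (\<Sum>i=1..a. if i = a then F a (Suc k) else 0)"
    unfolding H_def by (intro sum.cong) (auto simp: Gk)
  ultimately show ?thesis using \<open>1 \<le> a\<close> by simp
qed

text \<open>The hypotheses make the discrete one-form \<open>\<phi> d\<psi>\<close> closed on every unit square; the conclusion
  compares its integrals along the two boundary paths from \<open>(1, m)\<close> to \<open>(a, k + 1)\<close>.\<close>
lemma closed_form_rectangle:
  fixes x \<phi> \<psi> :: "nat \<Rightarrow> nat \<Rightarrow> real"
  assumes "m \<le> k" "1 \<le> a"
    and pos: "\<And>i j. 1 \<le> i \<Longrightarrow> i \<le> a \<Longrightarrow> m \<le> j \<Longrightarrow> j \<le> Suc k \<Longrightarrow> x i j > 0"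
    and \<phi>: "\<And>i j. 1 \<le> i \<Longrightarrow> i < a \<Longrightarrow> m \<le> j \<Longrightarrow> j \<le> k \<Longrightarrow>
      \<phi> i j * (x (Suc i) j + x i (Suc j)) = \<phi> (Suc i) j * x i (Suc j) + \<phi> i (Suc j) * x (Suc i) j"
    and \<phi>a: "\<And>j. m \<le> j \<Longrightarrow> j \<le> k \<Longrightarrow> \<phi> a j = \<phi> a (Suc j)"
    and \<phi>k: "\<And>i. 1 \<le> i \<Longrightarrow> i < a \<Longrightarrow> \<phi> i (Suc k) = 0"
    and \<psi>: "\<And>i j. 1 \<le> i \<Longrightarrow> i < a \<Longrightarrow> m \<le> j \<Longrightarrow> j \<le> k \<Longrightarrow>
      \<psi> (Suc i) (Suc j) * (x (Suc i) j + x i (Suc j)) = \<psi> (Suc i) j * x (Suc i) j + \<psi> i (Suc j) * x i (Suc j)"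
    and \<psi>1: "\<And>j. m \<le> j \<Longrightarrow> j \<le> k \<Longrightarrow> \<psi> 1 (Suc j) = \<psi> 1 j"
    and \<psi>m: "\<And>i. 1 < i \<Longrightarrow> i \<le> a \<Longrightarrow> \<psi> i m = 0"
  shows "\<phi> a (Suc k) * \<psi> a (Suc k) = \<phi> 1 m * \<psi> 1 m"
proof (cases "a = 1")
  case True
  have "\<phi> 1 n = \<phi> 1 m \<and> \<psi> 1 n = \<psi> 1 m" if "m \<le> n" "n \<le> Suc k" for n
    using that
  proof (induction n rule: dec_induct)
    case (step n)
    then show ?case using \<phi>a[of n] \<psi>1[of n] True by simp
  qed simp
  from this[of "Suc k"] show ?thesis using True \<open>m \<le> k\<close> by simp
next
  case False
  \<comment> \<open>\<open>R i\<close> integrates along row \<open>i\<close>, and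
    \<open>C i j\<close> along the edge from \<open>(i, j)\<close> to \<open>(i + 1, j)\<close>;
    every edge takes \<open>\<phi>\<close> at its starting point.\<close>
  define R where "R i = (\<Sum>j=m..k. \<phi> i j * (\<psi> i (Suc j) - \<psi> i j))" for i
  define C where "C i j = \<phi> i j * (\<psi> (Suc i) j - \<psi> i j)" for i j
  have square: "\<phi> (Suc i) j * (\<psi> (Suc i) (Suc j) - \<psi> (Suc i) j) - \<phi> i j * (\<psi> i (Suc j) - \<psi> i j)
      = C i (Suc j) - C i j" if "1 \<le> i" "i < a" "m \<le> j" "j \<le> k" for i j
  proof -
    have "(x (Suc i) j + x i (Suc j)) * (\<phi> (Suc i) j * (\<psi> (Suc i) (Suc j) - \<psi> (Suc i) j)
        - \<phi> i j * (\<psi> i (Suc j) - \<psi> i j) - (C i (Suc j) - C i j)) = 0"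
      using \<phi>[OF that] \<psi>[OF that] unfolding C_def by algebra
    moreover have "x (Suc i) j + x i (Suc j) > 0"
      using pos[of "Suc i" j] pos[of i "Suc j"] that by simp
    ultimately show ?thesis by simp
  qed
  have row: "R (Suc i) - R i = C i (Suc k) - C i m" if "1 \<le> i" "i < a" for i
  proof -
    have "R (Suc i) - R i = (\<Sum>j=m..k. C i (Suc j) - C i j)"
      unfolding R_def sum_subtractf[symmetric] by (intro sum.cong square) (use that in auto)
    also have "\<dots> = C i (Suc k) - C i m"
      by (rule sum_Suc_diff) (use \<open>m \<le> k\<close> in simp)
    finally show ?thesis .
  qed
  \<comment> \<open>Between rows 1 and 2 only the edge in column \<open>m\<close> contributes; from
    row 2 on neither boundary edge does, so \<open>R\<close> stays constant.\<close>
  have "R 1 = 0" unfolding R_def by (simp add: \<psi>1 del: One_nat_def)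
  then have R2: "R 2 = \<phi> 1 m * \<psi> 1 m"
    using row[of 1] False \<open>1 \<le> a\<close> \<phi>k[of 1] \<psi>m[of 2] by (simp add: C_def numeral_2_eq_2)
  have "2 \<le> i \<Longrightarrow> i \<le> a \<Longrightarrow> R i = \<phi> 1 m * \<psi> 1 m" for i
  proof (induction i rule: dec_induct)
    case (step i)
    then show ?case using row[of i] \<phi>k[of i] \<psi>m[of i] \<psi>m[of "Suc i"] by (simp add: C_def)
  qed (rule R2)
  then have "R a = \<phi> 1 m * \<psi> 1 m" using False \<open>1 \<le> a\<close> by simp
  moreover have "\<phi> a n = \<phi> a (Suc k)" if "m \<le> n" "n \<le> Suc k" for n
    using that(2,1)
  proof (induction n rule: inc_induct)
    case (step n)
    then show ?case using \<phi>a[of n] by simp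
  qed simp
  then have "\<phi> a j * (\<psi> a (Suc j) - \<psi> a j) = \<phi> a (Suc k) * (\<psi> a (Suc j) - \<psi> a j)" if "j \<in> {m..k}" for j
    using that by (metis atLeastAtMost_iff le_SucI)
  then have "R a = (\<Sum>j=m..k. \<phi> a (Suc k) * (\<psi> a (Suc j) - \<psi> a j))"
    unfolding R_def by (intro sum.cong) auto
  then have "R a = \<phi> a (Suc k) * (\<psi> a (Suc k) - \<psi> a m)"
    by (subst (asm) sum_distrib_left[symmetric], subst (asm) sum_Suc_diff) (use \<open>m \<le> k\<close> in auto)
  ultimately show ?thesis using \<psi>m[of a] False \<open>1 \<le> a\<close> by simp
qed

text \<open>The value 1 at \<open>(1, 0)\<close> is the source of the paths. Translating or rotating
  this one model gives both kinds of path sums below.\<close>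

fun path_sum :: "(nat \<Rightarrow> nat \<Rightarrow> real) \<Rightarrow> nat \<Rightarrow> nat \<Rightarrow> real" where
  "path_sum w 0 j = 0"
| "path_sum w (Suc i) 0 = (if i = 0 then 1 else 0)"
| "path_sum w (Suc i) (Suc j) = w (Suc i) (Suc j) * (path_sum w i (Suc j) + path_sum w (Suc i) j)"

subsection \<open>Birational orbits\<close>

text \<open>The border values encode the added bottom and top (with labels \<open>1\<close> and \<open>\<beta>\<close>) as the fictitious cells
  \<open>(1, 0)\<close> and \<open>(a, b + 1)\<close>; the other fictitious cells carry \<open>0\<close>, which contributes nothing to a sum
  of labels, nor to a sum of inverses of labels because \<open>inverse 0 = 0\<close>.\<close>
definition positive_labelling :: "nat \<Rightarrow> nat \<Rightarrow> real \<Rightarrow> (nat \<Rightarrow> nat \<Rightarrow> real) \<Rightarrow> bool" where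
  "positive_labelling a b \<beta> X \<longleftrightarrow>
     (\<forall>j. X 0 j = 0) \<and> (\<forall>j. X (Suc a) j = 0) \<and> (\<forall>i. X i 0 = (if i = 1 then 1 else 0)) \<and>
     (\<forall>i. X i (Suc b) = (if i = a then \<beta> else 0)) \<and> (\<forall>i\<in>{1..a}. \<forall>j\<in>{1..b}. X i j > 0)"

lemma positive_labelling_lower_pos:
  assumes X: "positive_labelling a b \<beta> X" and ij: "1 \<le> i" "i \<le> a" "1 \<le> j" "j \<le> b"
  shows "X (i - 1) j + X i (j - 1) > 0"
proof -
  have pos: "X i j > 0" if "1 \<le> i" "i \<le> a" "1 \<le> j" "j \<le> b" for i j
    using X that by (auto simp: positive_labelling_def)
  have border: "X 0 j = 0" "X i 0 = (if i = 1 then 1 else 0)" for i j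
    using X by (auto simp: positive_labelling_def)
  consider "i = 1" "j = 1" | "i = 1" "j > 1" | "i > 1" "j = 1" | "i > 1" "j > 1" using ij by linarith
  then show ?thesis by cases (use ij in \<open>auto simp: border intro!: pos add_pos_pos\<close>)
qed

text \<open>The recurrence has old labels below the cell and new ones above it, since rowmotion
  toggles from top to bottom.\<close>

locale birational_orbit =
  fixes a b :: nat and \<beta> :: real and X :: "nat \<Rightarrow> nat \<Rightarrow> nat \<Rightarrow> real"
  assumes a: "1 \<le> a" and b: "1 \<le> b" and \<beta>: "\<beta> > 0"
    and labelling: "positive_labelling a b \<beta> (X l)"
    and recurrence: "1 \<le> i \<Longrightarrow> i \<le> a \<Longrightarrow> 1 \<le> j \<Longrightarrow> j \<le> b \<Longrightarrow>
      X (Suc l) i j * X l i j * (inverse (X (Suc l) (Suc i) j) + inverse (X (Suc l) i (Suc j)))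
      = X l (i - 1) j + X l i (j - 1)"
begin

lemma row_0: "X l 0 j = 0" and row_a: "X l (Suc a) j = 0"
  and col_0: "X l i 0 = (if i = 1 then 1 else 0)"
  and col_b: "X l i (Suc b) = (if i = a then \<beta> else 0)"
  and pos: "1 \<le> i \<Longrightarrow> i \<le> a \<Longrightarrow> 1 \<le> j \<Longrightarrow> j \<le> b \<Longrightarrow> X l i j > 0"
  using labelling[of l] by (auto simp: positive_labelling_def)

definition A :: "nat \<Rightarrow> nat \<Rightarrow> nat \<Rightarrow> real" where
  "A l i j = X l i j / (X l (i - 1) j + X l i (j - 1))"

definition V :: "nat \<Rightarrow> nat \<Rightarrow> nat \<Rightarrow> real" where
  "V l i j = inverse (X l i j * (inverse (X l (Suc i) j) + inverse (X l i (Suc j))))"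

lemmas lower_pos = positive_labelling_lower_pos[OF labelling]

lemma upper_pos:
  assumes "1 \<le> i" "i \<le> a" "1 \<le> j" "j \<le> b"
  shows "inverse (X l (Suc i) j) + inverse (X l i (Suc j)) > 0"
proof -
  consider "i = a" "j = b" | "i = a" "j < b" | "i < a" "j = b" | "i < a" "j < b"
    using assms by linarith
  then show ?thesis
    by cases (use assms \<beta> pos[of "Suc i" j l] pos[of i "Suc j" l] in \<open>auto simp: row_a col_b intro: add_pos_pos\<close>)
qed

text \<open>The recurrence divided out: it links successive times, as weights of upward recursions
  at time \<open>l + 1\<close> are weights of downward ones at time \<open>l\<close>.\<close>

lemma V_Suc:
  assumes "1 \<le> i" "i \<le> a" "1 \<le> j" "j \<le> b"
  shows "V (Suc l) i j = A l i j"
proof -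
  have cancel: "inverse (p * u) = q / (p * q * u)" if "q > 0" for p q u :: real
    using that by (simp add: divide_simps)
  show ?thesis
    unfolding V_def A_def recurrence[OF assms, symmetric] using pos[OF assms] by (rule cancel)
qed

lemma X_A: 
  assumes "1 \<le> i" "i \<le> a" "1 \<le> j" "j \<le> b"
  shows "X l i j = A l i j * (X l (i - 1) j + X l i (j - 1))"
  using lower_pos[OF assms, of l] by (simp add: A_def)

lemma inverse_X_V: 
  assumes "1 \<le> i" "i \<le> a" "1 \<le> j" "j \<le> b"
  shows "inverse (X l i j) = V l i j * (inverse (X l (Suc i) j) + inverse (X l i (Suc j)))"
  using upper_pos[OF assms, of l] by (simp add: V_def)

text \<open>\<open>F\<close> sums the products of the \<open>A l\<close> over the lattice paths descending to \<open>(1, m + 1)\<close>.\<close>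
definition A_path_sum :: "nat \<Rightarrow> nat \<Rightarrow> (nat \<Rightarrow> nat \<Rightarrow> real) \<Rightarrow> bool" where
  "A_path_sum l m F \<longleftrightarrow> (\<forall>j. F 0 j = 0) \<and> (\<forall>i\<in>{1..a}. F i m = (if i = 1 then 1 else 0)) \<and>
     (\<forall>i\<in>{1..a}. \<forall>j\<in>{Suc m..b}. F i j = A l i j * (F (i - 1) j + F i (j - 1)))"

lemma A_path_sum_exists: "\<exists>F. A_path_sum l m F"
proof
  let ?w = "\<lambda>i c. A l i (c + m)"
  let ?F = "\<lambda>i j. path_sum ?w i (j - m)"
  have "?F i j = A l i j * (?F (i - 1) j + ?F i (j - 1))" if "1 \<le> i" "Suc m \<le> j" for i j
  proof -
    obtain i' where i': "i = Suc i'" using \<open>1 \<le> i\<close> by (cases i) auto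
    obtain c where c: "j = Suc c + m" using le_Suc_ex[OF \<open>Suc m \<le> j\<close>] by auto
    show ?thesis by (simp add: i' c)
  qed
  moreover have "?F i m = (if i = 1 then 1 else 0)" if "1 \<le> i" for i
    using that by (cases i) auto
  ultimately show "A_path_sum l m ?F" unfolding A_path_sum_def by auto
qed

lemma V_path_sum_exists:
  "\<exists>G. (\<forall>j. G (Suc a) j = 0) \<and> (\<forall>i\<in>{1..a}. G i (Suc k) = (if i = a then 1 else 0)) \<and>
     (\<forall>i\<in>{1..a}. \<forall>j\<in>{1..k}. G i j = V l i j * (G (Suc i) j + G i (Suc j)))"
proof -
  \<comment> \<open>The half turn \<open>(i, j)\<close> to \<open>(a + 1 - i, k + 1 - j)\<close>
    makes the recursion from above that of \<open>path_sum\<close>.\<close>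
  let ?w = "\<lambda>i c. V l (Suc a - i) (Suc k - c)"
  let ?G = "\<lambda>i j. path_sum ?w (Suc a - i) (Suc k - j)"
  have "?G i j = V l i j * (?G (Suc i) j + ?G i (Suc j))" if "1 \<le> i" "i \<le> a" "1 \<le> j" "j \<le> k" for i j
    using that by (simp add: Suc_diff_le)
  moreover have "?G i (Suc k) = (if i = a then 1 else 0)" if "1 \<le> i" "i \<le> a" for i
    using that by (auto simp: Suc_diff_le)
  ultimately show ?thesis by (intro exI[of _ ?G]) auto
qed

text \<open>For \<open>X l * G\<close> and \<open>F / X l\<close> the recurrences become weighted
  means on each unit square, with the same two weights \<open>X l (i + 1) j\<close> and
  \<open>X l i (j + 1)\<close>. So \<open>closed_form_rectangle\<close> applies, and the labels
  cancel at both corners.\<close>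

lemma path_sum_conversion:
  assumes F: "A_path_sum l m F" and mk: "1 \<le> m" "m \<le> k" "k < b"
    and Ga: "\<And>j. G (Suc a) j = 0" and Gk: "\<forall>i\<in>{1..a}. G i (Suc k) = (if i = a then 1 else 0)"
    and G: "\<forall>i\<in>{1..a}. \<forall>j\<in>{1..k}. G i j = V l i j * (G (Suc i) j + G i (Suc j))"
  shows "F a (Suc k) = G 1 m"
proof -
  let ?\<phi> = "\<lambda>i j. X l i j * G i j" and ?\<psi> = "\<lambda>i j. F i j / X l i j"
  have X0: "X l i j > 0" if "1 \<le> i" "i \<le> a" "m \<le> j" "j \<le> Suc k" for i j
    using that mk by (intro pos) auto
  have F0: "F 0 j = 0" for j using F by (auto simp: A_path_sum_def)
  have Frec: "F i j = A l i j * (F (i - 1) j + F i (j - 1))"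
    if "1 \<le> i" "i \<le> a" "m < j" "j \<le> Suc k" for i j
    using F that mk by (auto simp: A_path_sum_def)
  have Fm: "F i m = (if i = 1 then 1 else 0)" if "1 \<le> i" "i \<le> a" for i
    using F that by (auto simp: A_path_sum_def)
  have "?\<phi> a (Suc k) * ?\<psi> a (Suc k) = ?\<phi> 1 m * ?\<psi> 1 m"
  proof (rule closed_form_rectangle[where x = "X l"])
    show "m \<le> k" "1 \<le> a" by (fact mk a)+
    show "X l i j > 0" if "1 \<le> i" "i \<le> a" "m \<le> j" "j \<le> Suc k" for i j
      using that by (rule X0)
    show "?\<phi> i j * (X l (Suc i) j + X l i (Suc j)) = ?\<phi> (Suc i) j * X l i (Suc j) + ?\<phi> i (Suc j) * X l (Suc i) j"
      if "1 \<le> i" "i < a" "m \<le> j" "j \<le> k" for i j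
    proof -
      have "G i j = V l i j * (G (Suc i) j + G i (Suc j))" using G that mk by auto
      moreover have "X l i j > 0" "X l (Suc i) j > 0" "X l i (Suc j) > 0" using that by (auto intro: X0)
      moreover from this have "X l (Suc i) j + X l i (Suc j) > 0" by simp
      ultimately show ?thesis by (simp add: V_def divide_simps) (simp add: algebra_simps)
    qed
    show "?\<phi> a j = ?\<phi> a (Suc j)" if "m \<le> j" "j \<le> k" for j
    proof -
      have "G a j = V l a j * G a (Suc j)" using G that mk a Ga by auto
      moreover have "X l a j > 0" "X l a (Suc j) > 0" using that a by (auto intro: X0)
      ultimately show ?thesis by (simp add: V_def row_a field_simps)
    qed
    show "?\<phi> i (Suc k) = 0" if "1 \<le> i" "i < a" for i using Gk that by auto
    show "?\<psi> (Suc i) (Suc j) * (X l (Suc i) j + X l i (Suc j)) = ?\<psi> (Suc i) j * X l (Suc i) j + ?\<psi> i (Suc j) * X l i (Suc j)"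
      if "1 \<le> i" "i < a" "m \<le> j" "j \<le> k" for i j
    proof -
      have "F (Suc i) (Suc j) = A l (Suc i) (Suc j) * (F i (Suc j) + F (Suc i) j)"
        using Frec[of "Suc i" "Suc j"] that by simp
      moreover have "X l (Suc i) (Suc j) > 0" "X l (Suc i) j > 0" "X l i (Suc j) > 0"
        using that by (auto intro: X0)
      moreover from this have "X l (Suc i) j + X l i (Suc j) > 0" by simp
      ultimately show ?thesis by (simp add: A_def field_simps)
    qed
    show "?\<psi> 1 (Suc j) = ?\<psi> 1 j" if "m \<le> j" "j \<le> k" for j
    proof -
      have "F 1 (Suc j) = A l 1 (Suc j) * F 1 j" using Frec[of 1 "Suc j"] that a F0 by simp
      moreover have "X l 1 j > 0" "X l 1 (Suc j) > 0" using X0[of 1] that a by auto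
      ultimately show ?thesis by (simp add: A_def row_0)
    qed
    show "?\<psi> i m = 0" if "1 < i" "i \<le> a" for i using that by (simp add: Fm)
  qed
  then show ?thesis using Gk Fm[of 1] X0[of a "Suc k"] X0[of 1 m] a mk by simp
qed

text \<open>Both sides equal one \<open>V (l + 1)\<close>-path sum:
  \<open>path_sum_conversion\<close> moves it one column at time \<open>l + 1\<close>, while
  \<open>V_Suc\<close> and \<open>path_sum_flow\<close> read it as an \<open>A l\<close>-path sum
  counted from the other end.\<close>

lemma A_path_sum_shift:
  assumes F: "A_path_sum l m F" and F': "A_path_sum (Suc l) (Suc m) F'" and mk: "m \<le> k" "Suc k < b"
  shows "F a (Suc k) = F' a (Suc (Suc k))"
proof -
  obtain G where G: "\<forall>j. G (Suc a) j = 0" "\<forall>i\<in>{1..a}. G i (Suc (Suc k)) = (if i = a then 1 else 0)"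
    "\<forall>i\<in>{1..a}. \<forall>j\<in>{1..Suc k}. G i j = V (Suc l) i j * (G (Suc i) j + G i (Suc j))"
    using V_path_sum_exists by blast
  have "F' a (Suc (Suc k)) = G 1 (Suc m)"
    by (rule path_sum_conversion[OF F']) (use G mk in auto)
  moreover have "F a (Suc k) = G 1 (Suc m)"
  proof (rule path_sum_flow[where w = "A l"])
    show "G i j = A l i j * (G (Suc i) j + G i (Suc j))"
      if "1 \<le> i" "i \<le> a" "Suc m \<le> j" "j \<le> Suc k" for i j
      using G(3) that mk V_Suc[of i j l] by auto
  qed (use F G mk a in \<open>auto simp: A_path_sum_def\<close>)
  ultimately show ?thesis by simp
qed

lemma A_path_sum_shifts:
  assumes "A_path_sum l 0 F" "A_path_sum (l + s) s F'" "Suc k + s \<le> b"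
  shows "F a (Suc k) = F' a (Suc k + s)"
  using assms
proof (induction s arbitrary: F')
  case 0
  \<comment> \<open>Without a shift both functions solve the same recursion with the same border,
    which determines them on the rectangle.\<close>
  have "F i j = F' i j" if "i \<le> a" "j \<le> b" for i j
    using that
  proof (induction "i + j" arbitrary: i j rule: less_induct)
    case less
    show ?case
    proof (cases "i = 0 \<or> j = 0")
      case True
      then show ?thesis using 0 less by (cases i) (auto simp: A_path_sum_def)
    next
      case False
      then have "F i j = A l i j * (F (i - 1) j + F i (j - 1))"
        "F' i j = A l i j * (F' (i - 1) j + F' i (j - 1))"
        using 0 less.prems by (auto simp: A_path_sum_def)
      then show ?thesis using less.hyps[of "i - 1" j] less.hyps[of i "j - 1"] less.prems False by simp
    qed
  qed
  then show ?case using 0 by simp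
next
  case (Suc s)
  obtain F'' where F'': "A_path_sum (l + s) s F''" using A_path_sum_exists by blast
  have "F a (Suc k) = F'' a (Suc k + s)" using Suc F'' by simp
  also have "\<dots> = F' a (Suc (Suc (k + s)))"
    using A_path_sum_shift[OF F'', of F' "k + s"] Suc.prems by simp
  finally show ?case by simp
qed

section \<open>Reciprocity of antipodal cells and the period\<close>

text \<open>\<open>X l\<close> is itself an \<open>A l\<close>-path sum from column 0. After
  \<open>j - 1\<close> shifts its end \<open>(a, b + 1 - j)\<close> reaches the corner
  \<open>(a, b)\<close>; there \<open>path_sum_flow\<close> counts the paths from above, which by
  \<open>V_Suc\<close> gives \<open>\<beta> / X\<close> at time \<open>l + j\<close>.\<close>

lemma reciprocity_edge:
  assumes "1 \<le> j" "j \<le> b"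
  shows "X (l + j) 1 j = \<beta> * inverse (X l a (Suc b - j))"
proof -
  obtain s where s: "j = Suc s" using assms by (cases j) auto
  obtain F where F: "A_path_sum (l + s) s F" using A_path_sum_exists by blast
  have X: "A_path_sum l 0 (X l)"
    by (auto simp: A_path_sum_def row_0 col_0 intro: X_A[unfolded One_nat_def])
  have "X l a (Suc (b - j)) = F a (Suc (b - j) + s)"
    using X F by (rule A_path_sum_shifts) (use assms s in simp)
  also have "Suc (b - j) + s = Suc (b - 1)" using assms s by simp
  also have "F a (Suc (b - 1)) = \<beta> * inverse (X (Suc (l + s)) 1 (Suc s))"
  proof (rule path_sum_flow[where w = "A (l + s)" and G = "\<lambda>i j. \<beta> * inverse (X (Suc (l + s)) i j)"])
    show "\<beta> * inverse (X (Suc (l + s)) i j) =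
        A (l + s) i j * (\<beta> * inverse (X (Suc (l + s)) (Suc i) j) + \<beta> * inverse (X (Suc (l + s)) i (Suc j)))"
      if "1 \<le> i" "i \<le> a" "Suc s \<le> j" "j \<le> Suc (b - 1)" for i j
      using that V_Suc[of i j "l + s"] inverse_X_V[of i j "Suc (l + s)"] b by (simp add: algebra_simps)
  qed (use F assms s a b \<beta> in \<open>auto simp: A_path_sum_def row_a col_b\<close>)
  finally have "X l a (Suc b - j) = \<beta> * inverse (X (l + j) 1 j)"
    using s assms(2) by (simp only: Suc_diff_le add_Suc_right)
  then show ?thesis using \<beta> by simp
qed

text \<open>Border labels do not change with time. The half turn swaps the bottom label 1 and the
  top label \<open>\<beta>\<close>; the other border labels are 0, and
  \<open>inverse 0 = 0\<close>.\<close>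

lemma reciprocity_border:
  assumes "i \<le> Suc a" "j \<le> Suc b" "i = 0 \<or> j = 0 \<or> j = Suc b"
  shows "X l' i j = \<beta> * inverse (X l (Suc a - i) (Suc b - j))"
proof -
  consider "i = 0" | "j = 0" "i \<noteq> 0" | "j = Suc b" "i \<noteq> 0" using assms by blast
  then show ?thesis
  proof cases
    case 2
    then show ?thesis using assms \<beta> by (auto simp: col_0 col_b)
  next
    case 3
    then show ?thesis using assms a by (auto simp: col_0 col_b)
  qed (simp add: row_0 row_a)
qed

text \<open>The recurrence at \<open>(i - 1, j)\<close> determines the label in row \<open>i\<close>
  from the two rows before it, and the induction hypothesis turns it into the recurrence at the
  antipodal cell. Truncation of the time at \<open>i = j = 0\<close> is harmless, as border labels
  are constant.\<close>

lemma reciprocity: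
  assumes "i \<le> a" "j \<le> Suc b"
  shows "X (l + i + j - 1) i j = \<beta> * inverse (X l (Suc a - i) (Suc b - j))"
  using assms
proof (induction i arbitrary: j l rule: less_induct)
  case (less i)
  consider "i = 0 \<or> j = 0 \<or> j = Suc b" | "i = 1" "1 \<le> j" "j \<le> b" | r where "i = Suc (Suc r)" "1 \<le> j" "j \<le> b"
  proof -
    have "i = 0 \<or> i = 1 \<or> (\<exists>r. i = Suc (Suc r))" by (cases i; cases "i - 1") auto
    moreover have "j = 0 \<or> j = Suc b \<or> 1 \<le> j \<and> j \<le> b" using less.prems by auto
    ultimately show ?thesis using that by blast
  qed
  then show ?case
  proof cases
    case 1
    then show ?thesis using less.prems reciprocity_border by simp
  next
    case 2
    then show ?thesis using reciprocity_edge[of j l] by simp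
  next
    case (3 r)
    define t where "t = l + Suc r + j - 1"
    define i' where "i' = a - r"
    define j' where "j' = Suc b - j"
    have bounds: "1 \<le> Suc r" "Suc r \<le> a" "1 \<le> i'" "i' \<le> a" "1 \<le> j'" "j' \<le> b"
      using 3 less.prems by (auto simp: i'_def j'_def)
    have e: "Suc a - Suc r = i'" "Suc a - r = Suc i'" "Suc a - i = i' - 1"
      "Suc b - Suc j = j' - 1" "Suc b - (j - 1) = Suc j'"
      using 3 less.prems by (auto simp: i'_def j'_def)
    have t: "Suc t = l + i + j - 1" "Suc l + Suc r + j - 1 = Suc t" "Suc l + r + j - 1 = t"
      "Suc l + Suc r + (j - 1) - 1 = t" "l + Suc r + Suc j - 1 = Suc t"
      using 3 by (auto simp: t_def)
    have h1: "X (Suc t) (Suc r) j = \<beta> * inverse (X (Suc l) i' j')"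
      using less.IH[of "Suc r" j "Suc l"] 3 less.prems unfolding e t j'_def[symmetric] by simp
    have h2: "X t (Suc r) j = \<beta> * inverse (X l i' j')"
      using less.IH[of "Suc r" j l] 3 less.prems unfolding e t j'_def[symmetric] t_def[symmetric] by simp
    have h3: "X t r j = \<beta> * inverse (X (Suc l) (Suc i') j')"
      using less.IH[of r j "Suc l"] 3 less.prems unfolding e t j'_def[symmetric] by simp
    have h4: "X t (Suc r) (j - 1) = \<beta> * inverse (X (Suc l) i' (Suc j'))"
      using less.IH[of "Suc r" "j - 1" "Suc l"] 3 less.prems unfolding e t by simp
    have h5: "X (Suc t) (Suc r) (Suc j) = \<beta> * inverse (X l i' (j' - 1))"
      using less.IH[of "Suc r" "Suc j" l] 3 less.prems unfolding e t by simp
    \<comment> \<open>By induction every label here except that of \<open>(i, j)\<close> is known;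
      comparison with \<open>rec2\<close>, the relation at the antipode \<open>(i', j')\<close> of
      \<open>(r + 1, j)\<close>, isolates it.\<close>
    have rec1: "X (Suc t) (Suc r) j * X t (Suc r) j * (inverse (X (Suc t) i j) + inverse (X (Suc t) (Suc r) (Suc j)))
        = X t r j + X t (Suc r) (j - 1)"
      using recurrence[of "Suc r" j t] 3 bounds by simp
    have rec2: "X (Suc l) i' j' * X l i' j' * (inverse (X (Suc l) (Suc i') j') + inverse (X (Suc l) i' (Suc j')))
        = X l (i' - 1) j' + X l i' (j' - 1)"
      using recurrence[of i' j' l] bounds by simp
    let ?P = "X (Suc l) i' j'" and ?Q = "X l i' j'"
    let ?I = "inverse (X (Suc l) (Suc i') j') + inverse (X (Suc l) i' (Suc j'))"
    have p: "?P > 0" "?Q > 0" using bounds by (auto intro: pos)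
    have "\<beta> * inverse ?P * (\<beta> * inverse ?Q) * (inverse (X (Suc t) i j) + X l i' (j' - 1) / \<beta>) = \<beta> * ?I"
      using rec1 unfolding h1 h2 h3 h4 h5 by (simp add: algebra_simps divide_inverse)
    moreover have "\<beta> * Y = P * Q * I" if "\<beta> * inverse P * (\<beta> * inverse Q) * Y = \<beta> * I" "P > 0" "Q > 0"
      for P Q Y I
      using that \<beta> by (simp add: divide_simps mult.commute)
    ultimately have "\<beta> * (inverse (X (Suc t) i j) + X l i' (j' - 1) / \<beta>) = ?P * ?Q * ?I"
      using p by blast
    also note rec2
    finally have "\<beta> * inverse (X (Suc t) i j) = X l (i' - 1) j'"
      using \<beta> by (simp add: algebra_simps)
    then have "X (Suc t) i j = \<beta> * inverse (X l (i' - 1) j')"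
      using \<beta> by (metis inverse_inverse_eq inverse_mult_distrib mult.assoc mult.left_neutral right_inverse less_irrefl)
    then show ?thesis unfolding t e j'_def .
  qed
qed

theorem periodic:
  assumes "1 \<le> i" "i \<le> a" "1 \<le> j" "j \<le> b"
  shows "X (l + (a + b)) i j = X l i j"
proof -
  \<comment> \<open>The delays to the antipodal cell and back add up to
    \<open>a + b\<close>.\<close>
  define t where "t = l + (Suc a - i) + (Suc b - j) - 1"
  have "X t (Suc a - i) (Suc b - j) = \<beta> * inverse (X l i j)"
    using reciprocity[of "Suc a - i" "Suc b - j" l] assms by (simp add: t_def)
  moreover have "X (t + i + j - 1) i j = \<beta> * inverse (X t (Suc a - i) (Suc b - j))"
    using reciprocity[of i j t] assms by simp
  moreover have "t + i + j - 1 = l + (a + b)" using assms by (simp add: t_def)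
  ultimately show ?thesis using \<beta> by simp
qed

end

subsection \<open>Tropical limits\<close>

text \<open>Growth rates tropicalise: products become sums, sums become maxima, and inverses change
  the sign, so sums of inverses yield minima.\<close>

definition log_growth :: "(nat \<Rightarrow> real) \<Rightarrow> real \<Rightarrow> bool" where
  "log_growth u L \<longleftrightarrow> (\<forall>t. u t > 0) \<and> (\<lambda>t. ln (u t) / real t) \<longlonglongrightarrow> L"

lemma log_growth_unique: "log_growth u L \<Longrightarrow> log_growth u M \<Longrightarrow> L = M"
  unfolding log_growth_def using LIMSEQ_unique by blast

lemma log_growth_exp: "log_growth (\<lambda>t. exp (real t * c)) c"
proof -
  have "(\<lambda>t. ln (exp (real t * c)) / real t) \<longlonglongrightarrow> c"
    by (intro tendsto_eventually eventually_mono[OF eventually_gt_at_top[of 0]]) simp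
  then show ?thesis by (simp add: log_growth_def)
qed

lemma log_growth_one: "log_growth (\<lambda>t. 1) 0"
  by (simp add: log_growth_def)

lemma log_growth_mult: "log_growth u L \<Longrightarrow> log_growth v M \<Longrightarrow> log_growth (\<lambda>t. u t * v t) (L + M)"
  unfolding log_growth_def by (auto simp: ln_mult_pos add_divide_distrib intro: tendsto_add)

lemma log_growth_inverse: "log_growth u L \<Longrightarrow> log_growth (\<lambda>t. inverse (u t)) (- L)"
  unfolding log_growth_def by (auto simp: ln_inverse dest: tendsto_minus)

lemma log_growth_divide: "log_growth u L \<Longrightarrow> log_growth v M \<Longrightarrow> log_growth (\<lambda>t. u t / v t) (L - M)"
  using log_growth_mult[OF _ log_growth_inverse, of u L v M] by (simp add: divide_inverse)

text \<open>The sum lies between the maximum and twice the maximum, and the factor 2 costs only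
  \<open>ln 2 / t\<close>.\<close>

lemma log_growth_add:
  assumes "log_growth u L" "log_growth v M"
  shows "log_growth (\<lambda>t. u t + v t) (max L M)"
proof -
  have pos: "u t > 0" "v t > 0" for t using assms by (auto simp: log_growth_def)
  let ?m = "\<lambda>t. max (ln (u t) / real t) (ln (v t) / real t)"
  have m: "?m \<longlonglongrightarrow> max L M" using assms by (auto simp: log_growth_def intro: tendsto_max)
  have "(\<lambda>t. ln 2 / real t) \<longlonglongrightarrow> 0" by (rule lim_const_over_n)
  then have upper: "(\<lambda>t. ?m t + ln 2 / real t) \<longlonglongrightarrow> max L M" using tendsto_add[OF m] by fastforce
  have eq: "?m t = ln (max (u t) (v t)) / real t" for t
    using pos[of t] by (auto simp: max_def divide_right_mono) (auto simp: divide_le_cancel)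
  have "(\<lambda>t. ln (u t + v t) / real t) \<longlonglongrightarrow> max L M"
  proof (rule tendsto_sandwich[OF _ _ m upper]; intro always_eventually allI)
    fix t
    show "?m t \<le> ln (u t + v t) / real t"
      unfolding eq using pos[of t] by (intro divide_right_mono) (auto simp: max_def)
    have "ln (u t + v t) \<le> ln (max (u t) (v t) * 2)"
      using pos[of t] by (subst ln_le_cancel_iff) (auto simp: max_def)
    also have "\<dots> = ln (max (u t) (v t)) + ln 2"
      using pos[of t] by (subst ln_mult_pos) (auto simp: max_def)
    finally show "ln (u t + v t) / real t \<le> ?m t + ln 2 / real t"
      unfolding eq by (simp add: add_divide_distrib[symmetric] divide_right_mono)
  qed
  then show ?thesis using pos by (simp add: log_growth_def add_pos_pos)
qed

subsection \<open>Birational rowmotion\<close>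

text \<open>Labels above the cell come from the new labelling, so the recursion climbs to the
  border, whose labels stay fixed.\<close>

function birational_rowmotion :: "nat \<Rightarrow> nat \<Rightarrow> (nat \<Rightarrow> nat \<Rightarrow> real) \<Rightarrow> nat \<Rightarrow> nat \<Rightarrow> real" where
  "birational_rowmotion a b X i j =
     (if 1 \<le> i \<and> i \<le> a \<and> 1 \<le> j \<and> j \<le> b
      then (X (i - 1) j + X i (j - 1)) /
        (X i j * (inverse (birational_rowmotion a b X (Suc i) j) + inverse (birational_rowmotion a b X i (Suc j))))
      else X i j)"
  by pat_completeness auto
termination by (relation "measure (\<lambda>(a, b, X, i, j). (Suc a - i) + (Suc b - j))") auto

declare birational_rowmotion.simps [simp del]

text \<open>The sum of inverses is a divisor in the recursion; its positivity is carried along from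
  the top down and later allows multiplying out.\<close>

lemma birational_rowmotion_positive:
  assumes X: "positive_labelling a b \<beta> X" and "\<beta> > 0" "1 \<le> i" "i \<le> a" "1 \<le> j" "j \<le> b"
  shows "birational_rowmotion a b X i j > 0 \<and>
    inverse (birational_rowmotion a b X (Suc i) j) + inverse (birational_rowmotion a b X i (Suc j)) > 0"
  using assms(3-)
proof (induction "(Suc a - i) + (Suc b - j)" arbitrary: i j rule: less_induct)
  case less
  let ?R = "birational_rowmotion a b X"
  have top: "?R (Suc a) j = 0" "?R i (Suc b) = (if i = a then \<beta> else 0)" for i j
    using X by (auto simp: birational_rowmotion.simps positive_labelling_def)
  have up: "i < a \<Longrightarrow> ?R (Suc i) j > 0" "j < b \<Longrightarrow> ?R i (Suc j) > 0"
    using less.hyps[of "Suc i" j] less.hyps[of i "Suc j"] less.prems by auto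
  have s: "inverse (?R (Suc i) j) + inverse (?R i (Suc j)) > 0"
  proof -
    consider "i = a" "j = b" | "i = a" "j < b" | "i < a" "j = b" | "i < a" "j < b"
      using less.prems by linarith
    then show ?thesis by cases (use up top \<open>\<beta> > 0\<close> in \<open>auto intro!: add_pos_pos\<close>)
  qed
  moreover have "?R i j > 0"
    using s positive_labelling_lower_pos[OF X less.prems] X less.prems
    by (subst birational_rowmotion.simps) (auto simp: positive_labelling_def)
  ultimately show ?case by blast
qed

lemma positive_labelling_birational_rowmotion:
  assumes "positive_labelling a b \<beta> X" "\<beta> > 0"
  shows "positive_labelling a b \<beta> (birational_rowmotion a b X)"
  using assms birational_rowmotion_positive[OF assms]
  by (auto simp: positive_labelling_def) (auto simp: birational_rowmotion.simps)

lemma birational_rowmotion_orbit: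
  assumes "1 \<le> a" "1 \<le> b" "\<beta> > 0" "positive_labelling a b \<beta> X"
  shows "birational_orbit a b \<beta> (\<lambda>l. (birational_rowmotion a b ^^ l) X)"
proof -
  let ?X = "\<lambda>l. (birational_rowmotion a b ^^ l) X"
  have pl: "positive_labelling a b \<beta> (?X l)" for l
    by (induction l) (use assms positive_labelling_birational_rowmotion in auto)
  show ?thesis
  proof
    show "?X (Suc l) i j * ?X l i j * (inverse (?X (Suc l) (Suc i) j) + inverse (?X (Suc l) i (Suc j)))
        = ?X l (i - 1) j + ?X l i (j - 1)" if ij: "1 \<le> i" "i \<le> a" "1 \<le> j" "j \<le> b" for i j l
    proof -
      have "?X l i j > 0" using pl[of l] ij by (auto simp: positive_labelling_def)
      moreover have "inverse (?X (Suc l) (Suc i) j) + inverse (?X (Suc l) i (Suc j)) > 0"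
        using birational_rowmotion_positive[OF pl[of l] \<open>\<beta> > 0\<close> ij] by simp
      moreover have "?X (Suc l) i j = (?X l (i - 1) j + ?X l i (j - 1)) /
          (?X l i j * (inverse (?X (Suc l) (Suc i) j) + inverse (?X (Suc l) i (Suc j))))"
        using ij by (simp add: birational_rowmotion.simps[of a b _ i j])
      ultimately show ?thesis by (simp add: less_imp_neq[symmetric])
    qed
  qed (use assms pl in \<open>auto simp: positive_labelling_def\<close>)
qed

subsection \<open>Piecewise-linear orbits\<close>

text \<open>Here \<open>u\<close> and \<open>v\<close> are the labels of the neighbours of \<open>p\<close> in the adjacent row and in the adjacent column;
  a label without a cell is ignored.\<close>
definition lower_max :: "nat \<times> nat \<Rightarrow> real \<Rightarrow> real \<Rightarrow> real" where
  "lower_max p u v = (if fst p = 1 then if snd p = 1 then 0 else v else if snd p = 1 then u else max u v)"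

definition upper_min :: "nat \<Rightarrow> nat \<Rightarrow> nat \<times> nat \<Rightarrow> real \<Rightarrow> real \<Rightarrow> real" where
  "upper_min a b p u v = (if fst p = a then if snd p = b then 1 else v else if snd p = b then u else min u v)"

text \<open>A property of sequences rather than of iterates of a map, so that time-shifted promotion
  orbits qualify as well.\<close>

definition pl_orbit :: "nat \<Rightarrow> nat \<Rightarrow> (nat \<Rightarrow> nat \<times> nat \<Rightarrow> real) \<Rightarrow> bool" where
  "pl_orbit a b x \<longleftrightarrow> (\<forall>l. \<forall>(i, j)\<in>grid a b. x (Suc l) (i, j) =
     lower_max (i, j) (x l (i - 1, j)) (x l (i, j - 1)) +
     upper_min a b (i, j) (x (Suc l) (Suc i, j)) (x (Suc l) (i, Suc j)) - x l (i, j))"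

text \<open>For each \<open>t\<close> the labels \<open>exp (t * x 0 p)\<close> start a birational
  orbit of period \<open>a + b\<close>. Its growth rates follow \<open>x\<close>, and uniqueness of
  limits transfers the period.\<close>

theorem pl_orbit_periodic:
  assumes ab: "1 \<le> a" "1 \<le> b" and orbit: "pl_orbit a b x" and p: "p \<in> grid a b"
  shows "x (l + (a + b)) p = x l p"
proof -
  \<comment> \<open>The top label has growth rate 1 and the bottom label 1 has growth rate 0, the
    values at the added top and bottom.\<close>
  define \<beta> where "\<beta> t = exp (real t * 1)" for t
  define Y where "Y t i j = (if i = 0 then 0 else if i = Suc a then 0 else if j = 0 then (if i = 1 then 1 else 0)
      else if j = Suc b then (if i = a then \<beta> t else 0) else exp (real t * x 0 (i, j)))" for t i j
  define X where "X t l = (birational_rowmotion a b ^^ l) (Y t)" for t l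
  interpret birational_orbit a b "\<beta> t" "X t" for t
    unfolding X_def
    by (rule birational_rowmotion_orbit)
      (use ab in \<open>auto simp: \<beta>_def Y_def positive_labelling_def\<close>)
  have growth: "log_growth (\<lambda>t. X t l i j) (x l (i, j))"
    if "1 \<le> i" "i \<le> a" "1 \<le> j" "j \<le> b" for l i j
    using that
  proof (induction l arbitrary: i j)
    case 0
    then show ?case using log_growth_exp[of "x 0 (i, j)"] by (simp add: X_def Y_def)
  next
    case (Suc l)
    from Suc.prems show ?case
    \<comment> \<open>Upper neighbours are needed at the new time, hence an inner induction from the
      top corner downwards.\<close>
    proof (induction "(Suc a - i) + (Suc b - j)" arbitrary: i j rule: less_induct)
      case (less i j)
      have lower: "log_growth (\<lambda>t. X t l (i - 1) j + X t l i (j - 1))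
          (lower_max (i, j) (x l (i - 1, j)) (x l (i, j - 1)))"
      proof -
        consider "i = 1" "j = 1" | "i = 1" "j > 1" | "i > 1" "j = 1" | "i > 1" "j > 1"
          using less.prems by linarith
        then show ?thesis
          by cases (use less.prems Suc.IH[of "i - 1" j] Suc.IH[of i "j - 1"] in
            \<open>auto simp: lower_max_def row_0 col_0 intro: log_growth_one log_growth_add\<close>)
      qed
      have up: "i < a \<Longrightarrow> log_growth (\<lambda>t. X t (Suc l) (Suc i) j) (x (Suc l) (Suc i, j))"
        "j < b \<Longrightarrow> log_growth (\<lambda>t. X t (Suc l) i (Suc j)) (x (Suc l) (i, Suc j))"
        using less.hyps[of "Suc i" j] less.hyps[of i "Suc j"] less.prems by auto
      have \<beta>': "log_growth (\<lambda>t. \<beta> t) 1" unfolding \<beta>_def by (rule log_growth_exp)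
      have minmax: "- min u v = max (- u) (- v)" for u v :: real by (simp add: min_def max_def)
      have upper: "log_growth (\<lambda>t. inverse (X t (Suc l) (Suc i) j) + inverse (X t (Suc l) i (Suc j)))
          (- upper_min a b (i, j) (x (Suc l) (Suc i, j)) (x (Suc l) (i, Suc j)))"
      proof -
        consider "i = a" "j = b" | "i = a" "j < b" | "i < a" "j = b" | "i < a" "j < b"
          using less.prems by linarith
        then show ?thesis
        proof cases
          case 4
          then show ?thesis
            using log_growth_add[OF log_growth_inverse[OF up(1)] log_growth_inverse[OF up(2)]]
            by (simp add: upper_min_def minmax)
        qed (use up[THEN log_growth_inverse] log_growth_inverse[OF \<beta>'] in
              \<open>simp_all add: upper_min_def row_a col_b\<close>)
      qed
      have "X t (Suc l) i j = (X t l (i - 1) j + X t l i (j - 1)) /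
          (X t l i j * (inverse (X t (Suc l) (Suc i) j) + inverse (X t (Suc l) i (Suc j))))" for t
        using less.prems by (simp add: X_def birational_rowmotion.simps[of a b _ i j])
      moreover have "x (Suc l) (i, j) = lower_max (i, j) (x l (i - 1, j)) (x l (i, j - 1)) -
          (x l (i, j) + - upper_min a b (i, j) (x (Suc l) (Suc i, j)) (x (Suc l) (i, Suc j)))"
        using orbit less.prems by (auto simp: pl_orbit_def grid_def)
      ultimately show ?case
        using log_growth_divide[OF lower log_growth_mult[OF Suc.IH[OF less.prems] upper]] by simp
    qed
  qed
  obtain i j where ij: "p = (i, j)" "1 \<le> i" "i \<le> a" "1 \<le> j" "j \<le> b" using p by (auto simp: grid_def)
  have "log_growth (\<lambda>t. X t l i j) (x (l + (a + b)) (i, j))"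
    using growth[of i j "l + (a + b)"] periodic[of i j _ l] ij by simp
  then show ?thesis using growth[of i j l] log_growth_unique ij by blast
qed

subsection \<open>Toggles\<close>

lemma covered_by_grid_lower:
  assumes "(i, j) \<in> grid a b"
  shows "covered_by (hat_set (grid a b)) (hat_le grid_le) y (Elt (i, j)) \<longleftrightarrow>
    i = 1 \<and> j = 1 \<and> y = Bot \<or> 1 < i \<and> y = Elt (i - 1, j) \<or> 1 < j \<and> y = Elt (i, j - 1)"
    (is "?L \<longleftrightarrow> ?R")
proof
  assume L: ?L
  \<comment> \<open>The cells just below \<open>(i, j)\<close> serve as test elements: one that lies
    above \<open>y\<close> must be \<open>y\<close>.\<close>
  then have between: "y = Elt z" if "z \<in> grid a b" "grid_le z (i, j)" "z \<noteq> (i, j)" "hat_le grid_le y (Elt z)" for z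
    using that by (auto simp: covered_by_def hat_set_def)
  have y: "hat_le grid_le y (Elt (i, j))" "y \<noteq> Elt (i, j)" "y \<in> hat_set (grid a b)"
    using L by (auto simp: covered_by_def)
  have step: "1 < i \<Longrightarrow> hat_le grid_le y (Elt (i - 1, j)) \<Longrightarrow> y = Elt (i - 1, j)"
    "1 < j \<Longrightarrow> hat_le grid_le y (Elt (i, j - 1)) \<Longrightarrow> y = Elt (i, j - 1)"
    using assms by (auto simp: grid_def intro!: between)
  show ?R
  proof (cases y)
    case Bot
    then show ?thesis using step assms by (cases "1 < i"; cases "1 < j") (auto simp: grid_def)
  next
    case (Elt z)
    obtain k l where z: "z = (k, l)" by (cases z)
    have kl: "k \<le> i" "l \<le> j" "1 \<le> k" "1 \<le> l" "k < i \<or> l < j"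
      using y unfolding Elt z by (auto simp: hat_set_def grid_def)
    then show ?thesis using step unfolding Elt z by (cases "k < i") auto
  qed (use y in simp)
next
  assume ?R
  then show ?L using assms by (auto simp: covered_by_def hat_set_def grid_def)
qed

lemma covered_by_grid_upper:
  assumes "(i, j) \<in> grid a b"
  shows "covered_by (hat_set (grid a b)) (hat_le grid_le) (Elt (i, j)) y \<longleftrightarrow>
    i = a \<and> j = b \<and> y = Top \<or> i < a \<and> y = Elt (Suc i, j) \<or> j < b \<and> y = Elt (i, Suc j)"
    (is "?L \<longleftrightarrow> ?R")
proof
  assume L: ?L
  then have between: "y = Elt z" if "z \<in> grid a b" "grid_le (i, j) z" "z \<noteq> (i, j)" "hat_le grid_le (Elt z) y" for z
    using that by (auto simp: covered_by_def hat_set_def)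
  have y: "hat_le grid_le (Elt (i, j)) y" "y \<noteq> Elt (i, j)" "y \<in> hat_set (grid a b)"
    using L by (auto simp: covered_by_def)
  have step: "i < a \<Longrightarrow> hat_le grid_le (Elt (Suc i, j)) y \<Longrightarrow> y = Elt (Suc i, j)"
    "j < b \<Longrightarrow> hat_le grid_le (Elt (i, Suc j)) y \<Longrightarrow> y = Elt (i, Suc j)"
    using assms by (auto simp: grid_def intro!: between)
  show ?R
  proof (cases y)
    case Top
    then show ?thesis using step assms by (cases "i < a"; cases "j < b") (auto simp: grid_def)
  next
    case (Elt z)
    obtain k l where z: "z = (k, l)" by (cases z)
    have kl: "i \<le> k" "j \<le> l" "k \<le> a" "l \<le> b" "i < k \<or> j < l"
      using y unfolding Elt z by (auto simp: hat_set_def grid_def)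
    then show ?thesis using step unfolding Elt z by (cases "i < k") auto
  qed (use y in simp)
next
  assume ?R
  then show ?L using assms by (auto simp: covered_by_def hat_set_def grid_def)
qed

lemma toggle_grid:
  assumes ij: "(i, j) \<in> grid a b"
  shows "toggle (grid a b) grid_le (i, j) f (i, j) =
    lower_max (i, j) (f (i - 1, j)) (f (i, j - 1)) + upper_min a b (i, j) (f (Suc i, j)) (f (i, Suc j)) - f (i, j)"
proof -
  have "{hat_f f y | y. covered_by (hat_set (grid a b)) (hat_le grid_le) y (Elt (i, j))} =
      (if i = 1 \<and> j = 1 then {0} else {}) \<union> (if 1 < i then {f (i - 1, j)} else {}) \<union> (if 1 < j then {f (i, j - 1)} else {})"
    unfolding covered_by_grid_lower[OF ij] by (auto intro: exI[of _ Bot] exI[of _ "Elt _"])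
  moreover have "{hat_f f y | y. covered_by (hat_set (grid a b)) (hat_le grid_le) (Elt (i, j)) y} =
      (if i = a \<and> j = b then {1} else {}) \<union> (if i < a then {f (Suc i, j)} else {}) \<union> (if j < b then {f (i, Suc j)} else {})"
    unfolding covered_by_grid_upper[OF ij] by (auto intro: exI[of _ Top] exI[of _ "Elt _"])
  moreover have "1 \<le> i" "i \<le> a" "1 \<le> j" "j \<le> b" using ij by (auto simp: grid_def)
  ultimately show ?thesis by (auto simp: toggle_def lower_max_def upper_min_def)
qed

text \<open>Nothing covers itself, so the maximum and the minimum do not see the changed
  label.\<close>

lemma toggle_involution: "toggle P le x (toggle P le x f) = f"
proof -
  have "hat_f (f(x := c)) y = hat_f f y" if "y \<noteq> Elt x" for c y using that by (cases y) auto
  then have "{hat_f (f(x := c)) y | y. covered_by (hat_set P) (hat_le le) y (Elt x)} =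
      {hat_f f y | y. covered_by (hat_set P) (hat_le le) y (Elt x)}"
    "{hat_f (f(x := c)) y | y. covered_by (hat_set P) (hat_le le) (Elt x) y} =
      {hat_f f y | y. covered_by (hat_set P) (hat_le le) (Elt x) y}" for c
    by (metis covered_by_def)+
  then show ?thesis by (simp add: toggle_def)
qed

lemma inj_fold_toggle: "inj (fold (toggle P le) xs)"
proof (induction xs)
  case (Cons x xs)
  have "inj (toggle P le x)" by (rule inj_on_inverseI) (rule toggle_involution)
  from inj_compose[OF Cons this] show ?case by (simp add: comp_def)
qed simp

lemma fold_toggle_other: "u \<notin> set xs \<Longrightarrow> fold (toggle P le) xs f u = f u"
  by (induction xs arbitrary: f) (auto simp: toggle_def)

text \<open>\<open>h\<close> is the labelling just before \<open>(i, j)\<close> is toggled: cells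
  outside \<open>ys\<close> still have their old labels, and cells outside
  \<open>(i, j) # zs\<close> already have their final ones.\<close>

lemma fold_toggle_grid:
  assumes "(i, j) \<in> grid a b" "(i, j) \<notin> set ys" "(i, j) \<notin> set zs"
    and g: "g = fold (toggle (grid a b) grid_le) (ys @ (i, j) # zs) f"
  obtains h where "\<And>u. u \<notin> set ys \<Longrightarrow> h u = f u" "\<And>u. u \<notin> set ((i, j) # zs) \<Longrightarrow> h u = g u"
    "g (i, j) = lower_max (i, j) (h (i - 1, j)) (h (i, j - 1)) + upper_min a b (i, j) (h (Suc i, j)) (h (i, Suc j)) - f (i, j)"
proof
  let ?T = "toggle (grid a b) grid_le"
  define h where "h = fold ?T ys f"
  show h: "h u = f u" if "u \<notin> set ys" for u using that by (simp add: h_def fold_toggle_other)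
  have gh: "g = fold ?T ((i, j) # zs) h" by (simp add: g h_def)
  show "h u = g u" if "u \<notin> set ((i, j) # zs)" for u
    unfolding gh using that by (rule fold_toggle_other[symmetric])
  have "g (i, j) = ?T (i, j) h (i, j)" using assms(3) by (simp add: gh fold_toggle_other)
  then show "g (i, j) = lower_max (i, j) (h (i - 1, j)) (h (i, j - 1)) + upper_min a b (i, j) (h (Suc i, j)) (h (i, Suc j)) - f (i, j)"
    using toggle_grid[OF assms(1)] h[OF assms(2)] by simp
qed

section \<open>Rowmotion and promotion as local recurrences\<close>

lemma linear_extension_grid: "\<exists>xs. linear_extension (grid a b) grid_le xs"
proof
  \<comment> \<open>Pairs are sorted lexicographically, which extends the componentwise
    order.\<close>
  let ?xs = "sorted_list_of_set (grid a b)"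
  have "finite (grid a b)" by (rule finite_subset[of _ "{1..a} \<times> {1..b}"]) (auto simp: grid_def)
  moreover have "p \<le> q" if "grid_le p q" for p q
    using that by (cases p; cases q) (auto simp: less_eq_prod_def)
  then have "k \<le> l" if "k < length ?xs" "l < length ?xs" "grid_le (?xs ! k) (?xs ! l)" for k l
    using that strict_sorted_list_of_set[of "grid a b"]
    by (metis leD not_le_imp_less sorted_wrt_nth_less)
  ultimately show "linear_extension (grid a b) grid_le ?xs"
    by (auto simp: linear_extension_def)
qed

lemma linear_extension_append_Cons:
  assumes "linear_extension P le (us @ v # ws)"
  shows "u \<in> set us \<Longrightarrow> \<not> le v u" "w \<in> set ws \<Longrightarrow> \<not> le w v"
proof -
  let ?xs = "us @ v # ws"
  have le: "k \<le> l" if "k < length ?xs" "l < length ?xs" "le (?xs ! k) (?xs ! l)" for k l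
    using assms that unfolding linear_extension_def by blast
  show "\<not> le v u" if "u \<in> set us"
  proof
    assume "le v u"
    moreover obtain k where "k < length us" "u = us ! k" using \<open>u \<in> set us\<close> by (auto simp: in_set_conv_nth)
    ultimately show False using le[of "length us" k] by (simp add: nth_append)
  qed
  show "\<not> le w v" if "w \<in> set ws"
  proof
    assume "le w v"
    moreover obtain k where "k < length ws" "w = ws ! k" using \<open>w \<in> set ws\<close> by (auto simp: in_set_conv_nth)
    ultimately show False using le[of "Suc (length us + k)" "length us"] by (simp add: nth_append)
  qed
qed

text \<open>The \<open>foldr\<close> toggles the last list element first, hence
  \<open>rev\<close>.\<close>

lemma pl_rowmotion_fold:
  obtains xs where "linear_extension (grid a b) grid_le xs"
    "pl_rowmotion (grid a b) grid_le = fold (toggle (grid a b) grid_le) (rev xs)"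
proof
  let ?xs = "SOME xs. linear_extension (grid a b) grid_le xs"
  show "linear_extension (grid a b) grid_le ?xs"
    by (rule someI_ex) (rule linear_extension_grid)
  have "foldr (\<lambda>x acc. T x \<circ> acc) xs id = fold T (rev xs)" for T :: "'b \<Rightarrow> 'c \<Rightarrow> 'c" and xs
    by (induction xs) auto
  then show "pl_rowmotion (grid a b) grid_le = fold (toggle (grid a b) grid_le) (rev ?xs)"
    by (simp add: pl_rowmotion_def)
qed

text \<open>Elements above \<open>(i, j)\<close> come later in a linear extension and are toggled
  earlier, so upper neighbours are new and lower ones old.\<close>

lemma pl_rowmotion_grid:
  assumes ij: "(i, j) \<in> grid a b" and g: "g = pl_rowmotion (grid a b) grid_le f"
  shows "g (i, j) = lower_max (i, j) (f (i - 1, j)) (f (i, j - 1)) +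
    upper_min a b (i, j) (g (Suc i, j)) (g (i, Suc j)) - f (i, j)"
proof -
  obtain xs where xs: "linear_extension (grid a b) grid_le xs"
    "pl_rowmotion (grid a b) grid_le = fold (toggle (grid a b) grid_le) (rev xs)"
    by (rule pl_rowmotion_fold)
  have "(i, j) \<in> set xs" "distinct xs" using xs(1) ij by (auto simp: linear_extension_def)
  then obtain us ws where split: "xs = us @ (i, j) # ws" "(i, j) \<notin> set us" "(i, j) \<notin> set ws"
    by (metis distinct_append distinct.simps(2) not_distinct_conv_prefix split_list disjoint_iff list.set_intros(1))
  note order = linear_extension_append_Cons[OF xs(1)[unfolded split(1)]]
  obtain h where h: "\<And>u. u \<notin> set (rev ws) \<Longrightarrow> h u = f u" "\<And>u. u \<notin> set ((i, j) # rev us) \<Longrightarrow> h u = g u"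
    "g (i, j) = lower_max (i, j) (h (i - 1, j)) (h (i, j - 1)) + upper_min a b (i, j) (h (Suc i, j)) (h (i, Suc j)) - f (i, j)"
    by (rule fold_toggle_grid[OF ij, of "rev ws" "rev us" g f]) (use split xs(2) g in auto)
  have "h (i - 1, j) = f (i - 1, j)" "h (i, j - 1) = f (i, j - 1)"
    using order(2)[of "(i - 1, j)"] order(2)[of "(i, j - 1)"] by (auto intro!: h(1))
  moreover have "h (Suc i, j) = g (Suc i, j)" "h (i, Suc j) = g (i, Suc j)"
    using order(1)[of "(Suc i, j)"] order(1)[of "(i, Suc j)"] by (auto intro!: h(2))
  ultimately show ?thesis using h(3) by simp
qed

lemma pl_rowmotion_outside: "p \<notin> grid a b \<Longrightarrow> pl_rowmotion (grid a b) grid_le f p = f p"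
  by (rule pl_rowmotion_fold[of a b]) (auto simp: linear_extension_def fold_toggle_other)

lemma set_sorted_list_of_grid_file: "set (sorted_list_of_set (grid_file a b k)) = grid_file a b k"
proof -
  have "finite (grid_file a b k)"
    by (rule finite_subset[of _ "{1..a} \<times> {1..b}"]) (auto simp: grid_def grid_file_def)
  then show ?thesis by simp
qed

lemma pl_promotion_fold:
  "pl_promotion a b = fold (toggle (grid a b) grid_le)
     (concat (map (\<lambda>k. sorted_list_of_set (grid_file a b k)) [1..<a + b]))"
proof -
  have "fold (file_toggle a b) ks = fold (toggle (grid a b) grid_le)
      (concat (map (\<lambda>k. sorted_list_of_set (grid_file a b k)) ks))" for ks
    by (induction ks) (auto simp: file_toggle_def)
  then show ?thesis by (simp add: pl_promotion_def)
qed

text \<open>The neighbours \<open>(i + 1, j)\<close> and \<open>(i, j - 1)\<close> lie in file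
  \<open>k - 1\<close> and are already toggled; \<open>(i - 1, j)\<close> and
  \<open>(i, j + 1)\<close> lie in file \<open>k + 1\<close> and are not.\<close>

lemma pl_promotion_grid:
  assumes ij: "(i, j) \<in> grid a b" and g: "g = pl_promotion a b f"
  shows "g (i, j) = lower_max (i, j) (f (i - 1, j)) (g (i, j - 1)) +
    upper_min a b (i, j) (g (Suc i, j)) (f (i, Suc j)) - f (i, j)"
proof -
  let ?l = "\<lambda>k. sorted_list_of_set (grid_file a b k)"
  define k where "k = j + a - i"
  have k: "1 \<le> k" "k < a + b" "(i, j) \<in> grid_file a b k" "int k = int j - int i + int a" "1 \<le> i" "1 \<le> j"
    using ij by (auto simp: k_def grid_def grid_file_def)
  then have "(i, j) \<in> set (?l k)" by (simp add: set_sorted_list_of_grid_file)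
  moreover have "distinct (?l k)" by simp
  ultimately obtain us ws where split: "?l k = us @ (i, j) # ws" "(i, j) \<notin> set us" "(i, j) \<notin> set ws"
    by (metis distinct_append distinct.simps(2) split_list disjoint_iff list.set_intros(1))
  define ys where "ys = concat (map ?l [1..<k]) @ us"
  define zs where "zs = ws @ concat (map ?l [Suc k..<a + b])"
  have "[1..<a + b] = [1..<k] @ k # [Suc k..<a + b]"
    using k by (metis le_add_diff_inverse less_imp_le upt_add_eq_append upt_conv_Cons)
  then have list: "concat (map ?l [1..<a + b]) = ys @ (i, j) # zs"
    by (simp add: ys_def zs_def split(1))
  have us: "set us \<subseteq> grid_file a b k" "set ws \<subseteq> grid_file a b k"
    using set_sorted_list_of_grid_file[of a b k] unfolding split(1) by auto
  have ys: "int (snd u) - int (fst u) + int a \<le> int k" if "u \<in> set ys" for u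
    using that us by (auto simp: ys_def set_sorted_list_of_grid_file) (auto simp: grid_file_def)
  have zs: "int (snd u) - int (fst u) + int a \<ge> int k" if "u \<in> set zs" for u
    using that us by (auto simp: zs_def set_sorted_list_of_grid_file) (auto simp: grid_file_def)
  have notin: "(i, j) \<notin> set ys" "(i, j) \<notin> set zs"
    using split k by (auto simp: ys_def zs_def set_sorted_list_of_grid_file) (auto simp: grid_file_def)
  have fold: "g = fold (toggle (grid a b) grid_le) (ys @ (i, j) # zs) f"
    unfolding g pl_promotion_fold list ..
  obtain h where h: "\<And>u. u \<notin> set ys \<Longrightarrow> h u = f u" "\<And>u. u \<notin> set ((i, j) # zs) \<Longrightarrow> h u = g u"
    "g (i, j) = lower_max (i, j) (h (i - 1, j)) (h (i, j - 1)) + upper_min a b (i, j) (h (Suc i, j)) (h (i, Suc j)) - f (i, j)"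
    by (rule fold_toggle_grid[OF ij notin fold]) blast
  have "h (i - 1, j) = f (i - 1, j)" "h (i, Suc j) = f (i, Suc j)"
    using ys[of "(i - 1, j)"] ys[of "(i, Suc j)"] k by (auto intro!: h(1))
  moreover have "h (Suc i, j) = g (Suc i, j)" "h (i, j - 1) = g (i, j - 1)"
    using zs[of "(Suc i, j)"] zs[of "(i, j - 1)"] k by (auto intro!: h(2))
  ultimately show ?thesis using h(3) by simp
qed

lemma pl_promotion_outside: "p \<notin> grid a b \<Longrightarrow> pl_promotion a b f p = f p"
proof -
  assume "p \<notin> grid a b"
  then have "p \<notin> grid_file a b k" for k by (auto simp: grid_file_def)
  then show ?thesis
    unfolding pl_promotion_fold by (intro fold_toggle_other) (simp add: set_sorted_list_of_grid_file)
qed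

subsection \<open>Periodicity\<close>

lemma funpow_outside:
  assumes "\<And>f. F f p = f p"
  shows "(F ^^ n) f p = f p"
  by (induction n) (auto simp: assms)

lemma pl_rowmotion_periodic:
  assumes "1 \<le> a" "1 \<le> b"
  shows "(pl_rowmotion (grid a b) grid_le ^^ (a + b)) f = f"
proof
  fix p
  let ?x = "\<lambda>l. (pl_rowmotion (grid a b) grid_le ^^ l) f"
  have "?x (Suc l) (i, j) = lower_max (i, j) (?x l (i - 1, j)) (?x l (i, j - 1)) +
      upper_min a b (i, j) (?x (Suc l) (Suc i, j)) (?x (Suc l) (i, Suc j)) - ?x l (i, j)"
    if "(i, j) \<in> grid a b" for l i j
    using pl_rowmotion_grid[OF that refl, of "?x l"] by simp
  then have "pl_orbit a b ?x"
    unfolding pl_orbit_def by (intro allI ballI; clarify)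
  then have "p \<in> grid a b \<Longrightarrow> ?x (0 + (a + b)) p = ?x 0 p"
    using assms by (intro pl_orbit_periodic) auto
  moreover have "p \<notin> grid a b \<Longrightarrow> ?x (a + b) p = f p"
    by (rule funpow_outside) (rule pl_rowmotion_outside)
  ultimately show "?x (a + b) p = f p" by auto
qed

text \<open>Shifting time by \<open>b - j\<close> in column \<open>j\<close> turns a promotion orbit into a rowmotion orbit.\<close>
lemma pl_orbit_promotion:
  "pl_orbit a b (\<lambda>l p. (pl_promotion a b ^^ (l + (b - snd p))) f p)"
proof -
  let ?y = "\<lambda>l. (pl_promotion a b ^^ l) f"
  have "?y (Suc l + (b - j)) (i, j) =
      lower_max (i, j) (?y (l + (b - j)) (i - 1, j)) (?y (l + (b - (j - 1))) (i, j - 1)) +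
      upper_min a b (i, j) (?y (Suc l + (b - j)) (Suc i, j)) (?y (Suc l + (b - Suc j)) (i, Suc j)) -
      ?y (l + (b - j)) (i, j)" if ij: "(i, j) \<in> grid a b" for i j l
  proof -
    have j: "1 \<le> j" "j \<le> b" using ij by (auto simp: grid_def)
    have time: "l + (b - (j - 1)) = Suc l + (b - j)" using j by simp
    \<comment> \<open>For \<open>j = b\<close> the truncated \<open>b - Suc j\<close> gives the
      wrong time, but \<open>upper_min\<close> then ignores that argument.\<close>
    have "upper_min a b (i, j) (?y (Suc l + (b - j)) (Suc i, j)) (?y (Suc l + (b - Suc j)) (i, Suc j)) =
        upper_min a b (i, j) (?y (Suc l + (b - j)) (Suc i, j)) (?y (l + (b - j)) (i, Suc j))"
    proof (cases "j = b")
      case False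
      then have "Suc l + (b - Suc j) = l + (b - j)" using j by simp
      then show ?thesis by (simp only:)
    qed (simp add: upper_min_def)
    then show ?thesis
      unfolding time using pl_promotion_grid[OF ij refl, of "?y (l + (b - j))"] by simp
  qed
  then show ?thesis unfolding pl_orbit_def snd_conv by (intro allI ballI; clarify)
qed

text \<open>Starting the shifted orbit at \<open>l = snd p\<close> puts every cell at time
  \<open>b\<close>; injectivity of toggles then cancels the \<open>b\<close>-th power.\<close>

lemma pl_promotion_periodic:
  assumes "1 \<le> a" "1 \<le> b"
  shows "(pl_promotion a b ^^ (a + b)) f = f"
proof -
  let ?\<pi> = "pl_promotion a b"
  have "(?\<pi> ^^ (b + (a + b))) f p = (?\<pi> ^^ b) f p" for p
  proof (cases "p \<in> grid a b")
    case True
    then have "snd p \<le> b" by (auto simp: grid_def)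
    then have "snd p + (a + b) + (b - snd p) = b + (a + b)" "snd p + (b - snd p) = b" by simp_all
    then show ?thesis
      using pl_orbit_periodic[OF assms pl_orbit_promotion[of a b f] True, of "snd p"] by (simp only:)
  next
    case False
    have "(?\<pi> ^^ l) f p = f p" for l
      by (rule funpow_outside) (rule pl_promotion_outside[OF False])
    then show ?thesis by simp
  qed
  then have "(?\<pi> ^^ b) ((?\<pi> ^^ (a + b)) f) = (?\<pi> ^^ b) f" by (auto simp: funpow_add)
  moreover have "inj (?\<pi> ^^ b)" unfolding pl_promotion_fold by (intro inj_fn inj_fold_toggle)
  ultimately show ?thesis by (simp add: inj_eq)
qed

subsection \<open>Minimality of the period\<close>

text \<open>The recurrence determines the new labels from the top down, so an explicit candidate
  need only satisfy it.\<close>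

lemma pl_rowmotion_eqI:
  assumes "\<And>i j. (i, j) \<in> grid a b \<Longrightarrow> g (i, j) = lower_max (i, j) (f (i - 1, j)) (f (i, j - 1)) +
    upper_min a b (i, j) (g (Suc i, j)) (g (i, Suc j)) - f (i, j)"
  shows "(i, j) \<in> grid a b \<Longrightarrow> pl_rowmotion (grid a b) grid_le f (i, j) = g (i, j)"
proof (induction "(Suc a - i) + (Suc b - j)" arbitrary: i j rule: less_induct)
  case less
  let ?g = "pl_rowmotion (grid a b) grid_le f"
  have "upper_min a b (i, j) (?g (Suc i, j)) (?g (i, Suc j)) = upper_min a b (i, j) (g (Suc i, j)) (g (i, Suc j))"
    using less.prems less.hyps[of "Suc i" j] less.hyps[of i "Suc j"] by (auto simp: upper_min_def grid_def)
  then show ?case using pl_rowmotion_grid[OF less.prems refl, of f] assms[OF less.prems] by simp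
qed

lemma pl_promotion_eqI:
  assumes "\<And>i j. (i, j) \<in> grid a b \<Longrightarrow> g (i, j) = lower_max (i, j) (f (i - 1, j)) (g (i, j - 1)) +
    upper_min a b (i, j) (g (Suc i, j)) (f (i, Suc j)) - f (i, j)"
  shows "(i, j) \<in> grid a b \<Longrightarrow> pl_promotion a b f (i, j) = g (i, j)"
\<comment> \<open>The new labels needed are those at \<open>(i + 1, j)\<close> and
  \<open>(i, j - 1)\<close>, so the induction starts from \<open>(a, 1)\<close>.\<close>
proof (induction "(Suc a - i) + j" arbitrary: i j rule: less_induct)
  case less
  let ?g = "pl_promotion a b f"
  have "upper_min a b (i, j) (?g (Suc i, j)) (f (i, Suc j)) = upper_min a b (i, j) (g (Suc i, j)) (f (i, Suc j))"
    using less.prems less.hyps[of "Suc i" j] by (auto simp: upper_min_def grid_def)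
  moreover have "lower_max (i, j) (f (i - 1, j)) (?g (i, j - 1)) = lower_max (i, j) (f (i - 1, j)) (g (i, j - 1))"
  proof (cases "j = 1")
    case False
    then have "?g (i, j - 1) = g (i, j - 1)"
      using less.prems by (intro less.hyps) (auto simp: grid_def)
    then show ?thesis by simp
  qed (simp add: lower_max_def)
  ultimately show ?case using pl_promotion_grid[OF less.prems refl, of f] assms[OF less.prems] by simp
qed

text \<open>From the constant 1, each step sends one more rank to 0, beginning at
  \<open>(1, 1)\<close>.\<close>

lemma pl_rowmotion_indicator_orbit:
  assumes "l < a + b" "(i, j) \<in> grid a b"
  shows "(pl_rowmotion (grid a b) grid_le ^^ l) (\<lambda>p. if p \<in> grid a b then 1 else 0) (i, j) =
    (if i + j > l + 1 then 1 else 0)"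
  using assms
proof (induction l arbitrary: i j)
  case 0
  then show ?case by (auto simp: grid_def)
next
  case (Suc l)
  define F where "F = (pl_rowmotion (grid a b) grid_le ^^ l) (\<lambda>p. if p \<in> grid a b then 1 else 0)"
  let ?g = "\<lambda>(i, j). if i + j > Suc l + 1 then 1 else 0"
  have f: "F (i, j) = (if i + j > l + 1 then 1 else 0)" if "(i, j) \<in> grid a b" for i j
    using that Suc by (simp add: F_def)
  have "pl_rowmotion (grid a b) grid_le F (i, j) = ?g (i, j)"
  proof (rule pl_rowmotion_eqI[OF _ Suc.prems(2)])
    fix i j assume ij: "(i, j) \<in> grid a b"
    then have bounds: "1 \<le> i" "i \<le> a" "1 \<le> j" "j \<le> b"
      and mem: "i \<noteq> 1 \<Longrightarrow> (i - 1, j) \<in> grid a b" "j \<noteq> 1 \<Longrightarrow> (i, j - 1) \<in> grid a b"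
      by (auto simp: grid_def)
    have "lower_max (i, j) (F (i - 1, j)) (F (i, j - 1)) = (if i + j > l + 2 then 1 else 0)"
      using bounds f[OF mem(1)] f[OF mem(2)] by (auto simp: lower_max_def)
    \<comment> \<open>The time bound enters at \<open>(a, b)\<close>, where the upper value is
      always 1.\<close>
    moreover have "upper_min a b (i, j) (?g (Suc i, j)) (?g (i, Suc j)) = (if i + j > l + 1 then 1 else 0)"
      using bounds Suc.prems(1) by (auto simp: upper_min_def)
    ultimately show "?g (i, j) = lower_max (i, j) (F (i - 1, j)) (F (i, j - 1)) +
        upper_min a b (i, j) (?g (Suc i, j)) (?g (i, Suc j)) - F (i, j)"
      using f[OF ij] by simp
  qed
  then show ?case by (simp add: F_def)
qed

text \<open>The columns fill with 1 from \<open>b\<close> down to 1 during the first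
  \<open>b\<close> steps; then the rows return to 0 from row 1 upwards.\<close>

lemma pl_promotion_zero_orbit:
  assumes "l < a + b" "(i, j) \<in> grid a b"
  shows "(pl_promotion a b ^^ l) (\<lambda>p. 0) (i, j) = (if l + j > b \<and> l < i + b then 1 else 0)"
  using assms
proof (induction l arbitrary: i j)
  case 0
  then show ?case by (auto simp: grid_def)
next
  case (Suc l)
  define F where "F = (pl_promotion a b ^^ l) (\<lambda>p. 0)"
  let ?g = "\<lambda>(i, j). if Suc l + j > b \<and> Suc l < i + b then 1 else 0"
  have f: "F (i, j) = (if l + j > b \<and> l < i + b then 1 else 0)" if "(i, j) \<in> grid a b" for i j
    using that Suc by (simp add: F_def)
  have "pl_promotion a b F (i, j) = ?g (i, j)"
  proof (rule pl_promotion_eqI[OF _ Suc.prems(2)])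
    fix i j assume ij: "(i, j) \<in> grid a b"
    then have bounds: "1 \<le> i" "i \<le> a" "1 \<le> j" "j \<le> b"
      and mem: "i \<noteq> 1 \<Longrightarrow> (i - 1, j) \<in> grid a b" "j \<noteq> b \<Longrightarrow> (i, Suc j) \<in> grid a b"
      by (auto simp: grid_def)
    have "lower_max (i, j) (F (i - 1, j)) (?g (i, j - 1)) = (if l + j > b \<and> Suc l < i + b then 1 else 0)"
      using bounds f[OF mem(1)] by (auto simp: lower_max_def)
    moreover have "upper_min a b (i, j) (?g (Suc i, j)) (F (i, Suc j)) = (if Suc l + j > b \<and> l < i + b then 1 else 0)"
      using bounds Suc.prems(1) f[OF mem(2)] by (auto simp: upper_min_def)
    ultimately show "?g (i, j) = lower_max (i, j) (F (i - 1, j)) (?g (i, j - 1)) +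
        upper_min a b (i, j) (?g (Suc i, j)) (F (i, Suc j)) - F (i, j)"
      using f[OF ij] bounds by auto
  qed
  then show ?case by (simp add: F_def)
qed

theorem theorem1:
  fixes a b :: nat
  assumes "a \<ge> 1" and "b \<ge> 1"
  defines "P \<equiv> grid a b" and "n \<equiv> a + b"
  shows "(\<forall>f\<in>order_polytope P grid_le. (pl_rowmotion P grid_le ^^ n) f = f)
       \<and> (\<forall>k. 0 < k \<and> k < n \<longrightarrow>
            (\<exists>f\<in>order_polytope P grid_le. (pl_rowmotion P grid_le ^^ k) f \<noteq> f))
       \<and> (\<forall>f\<in>order_polytope P grid_le. (pl_promotion a b ^^ n) f = f)
       \<and> (\<forall>k. 0 < k \<and> k < n \<longrightarrow>
            (\<exists>f\<in>order_polytope P grid_le. (pl_promotion a b ^^ k) f \<noteq> f))"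
proof (intro conjI ballI allI impI)
  show "(pl_rowmotion P grid_le ^^ n) f = f" "(pl_promotion a b ^^ n) f = f" for f
    using pl_rowmotion_periodic pl_promotion_periodic assms by simp_all
next
  fix k assume k: "0 < k \<and> k < n"
  let ?f = "\<lambda>p. if p \<in> grid a b then 1 else 0 :: real"
  \<comment> \<open>The minimal cell drops to 0 at time 1 and stays there until time
    \<open>n - 1\<close>.\<close>
  have "(pl_rowmotion P grid_le ^^ k) ?f (1, 1) \<noteq> ?f (1, 1)"
    using pl_rowmotion_indicator_orbit[of k a b 1 1] k assms by (simp add: grid_def)
  then have "(pl_rowmotion P grid_le ^^ k) ?f \<noteq> ?f"
    using fun_cong[of _ ?f "(1, 1)"] by blast
  moreover have "?f \<in> order_polytope P grid_le" by (auto simp: order_polytope_def P_def)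
  ultimately show "\<exists>f\<in>order_polytope P grid_le. (pl_rowmotion P grid_le ^^ k) f \<noteq> f" by blast
next
  fix k assume k: "0 < k \<and> k < n"
  \<comment> \<open>The corner \<open>(a, b)\<close> is among the first cells to become 1 and keeps
    that value until time \<open>n - 1\<close>.\<close>
  have "(pl_promotion a b ^^ k) (\<lambda>p. 0) (a, b) \<noteq> 0"
    using pl_promotion_zero_orbit[of k a b a b] k assms by (simp add: grid_def)
  then have "(pl_promotion a b ^^ k) (\<lambda>p. 0) \<noteq> (\<lambda>p. 0)"
    using fun_cong[of _ "\<lambda>p. 0" "(a, b)"] by blast
  moreover have "(\<lambda>p. 0) \<in> order_polytope P grid_le" by (auto simp: order_polytope_def)
  ultimately show "\<exists>f\<in>order_polytope P grid_le. (pl_promotion a b ^^ k) f \<noteq> f" by blast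
qed

end
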